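(* Let $n,i,j$ be integers with $1\le i<j\le n$, let $k$ be a field of characteristic zero, let $R=k[x_1,\dots,x_n]$, and let $I=(x_1^2,\dots,x_n^2)+\mathrm{RLex}(x_ix_j)$. Then $A=R/I$ has the strong Lefschetz property.
   Context: The reverse lexicographic order with $x_1>\cdots>x_n$: for two monomials of the same degree, $x_1^{a_1}\cdots x_n^{a_n}>x_1^{b_1}\cdots x_n^{b_n}$ if the last non-zero entry of $(a_1,\dots,a_n)-(b_1,\dots,b_n)$ is negative. For $1\le i<j\le n$, $\mathrm{RLex}(x_ix_j)$ is the ideal of $R$ generated by all square-free monomials of degree 2 that are greater than or equal to $x_ix_j$ in this order; that is, by all $x_ax_b$ with $1\le a<b\le j-1$ together with $x_ax_j$ for $1\le a\le i$. A standard graded artinian $k$-algebra $A$ has the strong Lefschetz property (SLP) if there is a linear form $\ell\in A_1$ such that for all integers $s,d\ge 0$ the multiplication map $\cdot\ell^s:A_d\to A_{d+s}$ has full rank (i.e. is injective or surjective). *)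

theory Defs
  imports "HOL-Library.Poly_Mapping" "HOL-Algebra.QuotRing"
begin

text \<open>
  The variables are x_1, x_2, ...; a monomial is represented by its exponent vector, and a polynomial
  by its finitely supported coefficient function on monomials. On this type, the product of
  \<^theory>\<open>HOL-Library.Poly_Mapping\<close> is the convolution product, i.e. the product of polynomials.
\<close>

type_synonym monomial = "nat \<Rightarrow>\<^sub>0 nat"
type_synonym 'k polynomial = "monomial \<Rightarrow>\<^sub>0 'k"

definition mono_poly :: "monomial \<Rightarrow> 'k::comm_ring_1 polynomial" where
  "mono_poly a = Poly_Mapping.single a 1"

abbreviation expo :: "nat \<Rightarrow> monomial" where
  "expo v \<equiv> Poly_Mapping.single v 1"

definition var :: "nat \<Rightarrow> 'k::comm_ring_1 polynomial" where
  "var v = mono_poly (expo v)"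

definition monomials :: "nat \<Rightarrow> monomial set" where
  "monomials n = {a. Poly_Mapping.keys a \<subseteq> {1..n}}"

definition mdeg :: "monomial \<Rightarrow> nat" where
  "mdeg a = (\<Sum>v\<in>Poly_Mapping.keys a. Poly_Mapping.lookup a v)"

definition sqfree_monomial :: "monomial \<Rightarrow> bool" where
  "sqfree_monomial a \<longleftrightarrow> (\<forall>v. Poly_Mapping.lookup a v \<le> 1)"

definition poly_ring :: "nat \<Rightarrow> 'k::comm_ring_1 polynomial ring" where
  "poly_ring n = \<lparr>carrier = {p. Poly_Mapping.keys p \<subseteq> monomials n},
     mult = (*), one = 1, zero = 0, add = (+)\<rparr>"

definition forms :: "nat \<Rightarrow> nat \<Rightarrow> 'k::comm_ring_1 polynomial set" where
  "forms n d = {p \<in> carrier (poly_ring n). \<forall>a\<in>Poly_Mapping.keys p. mdeg a = d}"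

text \<open>
  \<open>revlex_greater a b\<close> means a > b. The index v is the position of the last non-zero entry of the
  difference of a and b, and that entry is negative; the entries are compared
  directly because subtraction on \<^typ>\<open>nat\<close> truncates.
\<close>

definition revlex_greater :: "monomial \<Rightarrow> monomial \<Rightarrow> bool" where
  "revlex_greater a b \<longleftrightarrow> mdeg a = mdeg b \<and>
     (\<exists>v. Poly_Mapping.lookup a v < Poly_Mapping.lookup b v \<and>
          (\<forall>w>v. Poly_Mapping.lookup a w = Poly_Mapping.lookup b w))"

definition RLex_gens :: "nat \<Rightarrow> monomial \<Rightarrow> monomial set" where
  "RLex_gens n m = {a \<in> monomials n. sqfree_monomial a \<and> mdeg a = 2 \<and> (revlex_greater a m \<or> a = m)}"

definition RLex :: "nat \<Rightarrow> monomial \<Rightarrow> 'k::comm_ring_1 polynomial set" where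
  "RLex n m = Idl\<^bsub>poly_ring n\<^esub> (mono_poly ` RLex_gens n m)"

definition squares_ideal :: "nat \<Rightarrow> 'k::comm_ring_1 polynomial set" where
  "squares_ideal n = Idl\<^bsub>poly_ring n\<^esub> {var v ^ 2 | v. v \<in> {1..n}}"

text \<open>
  For a homogeneous ideal I, the degree d component of the quotient of \<^term>\<open>poly_ring n\<close> by I is
  the image of the forms of degree d.
\<close>

definition quot_component :: "nat \<Rightarrow> 'k::comm_ring_1 polynomial set \<Rightarrow> nat \<Rightarrow> 'k polynomial set set"
  where "quot_component n I d = (\<lambda>p. I +>\<^bsub>poly_ring n\<^esub> p) ` forms n d"

text \<open>The function \<open>gr\<close> gives the homogeneous components of the graded algebra A.\<close>

definition strong_Lefschetz :: "('a, 'b) ring_scheme \<Rightarrow> (nat \<Rightarrow> 'a set) \<Rightarrow> bool" where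
  "strong_Lefschetz A gr \<longleftrightarrow>
     (\<exists>l \<in> gr 1. \<forall>s d.
        inj_on (\<lambda>a. (l [^]\<^bsub>A\<^esub> s) \<otimes>\<^bsub>A\<^esub> a) (gr d) \<or>
        (\<lambda>a. (l [^]\<^bsub>A\<^esub> s) \<otimes>\<^bsub>A\<^esub> a) ` gr d = gr (d + s))"

lemma monomials_add: "a \<in> monomials n \<Longrightarrow> b \<in> monomials n \<Longrightarrow> a + b \<in> monomials n"
  using Poly_Mapping.keys_add[of a b] by (auto simp: monomials_def)

lemma cring_poly_ring: "cring (poly_ring n :: 'k::comm_ring_1 polynomial ring)"
proof (rule cringI)
  show "abelian_group (poly_ring n :: 'k polynomial ring)"
  proof (rule abelian_groupI)
    fix p :: "'k polynomial" assume "p \<in> carrier (poly_ring n)"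
    then show "\<exists>q\<in>carrier (poly_ring n). q \<oplus>\<^bsub>poly_ring n\<^esub> p = \<zero>\<^bsub>poly_ring n\<^esub>"
      by (intro bexI[of _ "- p"]) (auto simp: poly_ring_def)
  qed (use Poly_Mapping.keys_add in \<open>fastforce simp: poly_ring_def add_ac\<close>)+
  show "Group.comm_monoid (poly_ring n :: 'k polynomial ring)"
  proof (rule comm_monoidI)
    fix p q :: "'k polynomial" assume "p \<in> carrier (poly_ring n)" "q \<in> carrier (poly_ring n)"
    then show "p \<otimes>\<^bsub>poly_ring n\<^esub> q \<in> carrier (poly_ring n)"
      using Poly_Mapping.keys_mult[of p q] monomials_add by (fastforce simp: poly_ring_def)
  qed (auto simp: poly_ring_def mult_ac monomials_def)
qed (auto simp: poly_ring_def algebra_simps)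

lemma mono_poly_carrier: "a \<in> monomials n \<Longrightarrow> mono_poly a \<in> carrier (poly_ring n)"
  by (simp add: mono_poly_def poly_ring_def)

lemma var_carrier: "v \<in> {1..n} \<Longrightarrow> var v \<in> carrier (poly_ring n)"
  unfolding var_def by (rule mono_poly_carrier) (simp add: monomials_def)

lemma ideal_squares_plus_RLex:
  "ideal (squares_ideal n <+>\<^bsub>poly_ring n\<^esub> RLex n m) (poly_ring n :: 'k::comm_ring_1 polynomial ring)"
proof -
  interpret cring "poly_ring n :: 'k polynomial ring" by (rule cring_poly_ring)
  have "{var v ^ 2 | v. v \<in> {1..n}} \<subseteq> carrier (poly_ring n :: 'k polynomial ring)"
  proof safe
    fix v assume "v \<in> {1..n}"
    from m_closed[OF var_carrier[OF this] var_carrier[OF this]]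
    show "(var v :: 'k polynomial) ^ 2 \<in> carrier (poly_ring n)"
      by (simp add: poly_ring_def power2_eq_square)
  qed
  moreover have "mono_poly ` RLex_gens n m \<subseteq> carrier (poly_ring n :: 'k polynomial ring)"
    by (auto simp: RLex_gens_def intro: mono_poly_carrier)
  ultimately show ?thesis
    unfolding squares_ideal_def RLex_def by (intro add_ideals genideal_ideal)
qed

lemma mdeg_expo_add:
  assumes "b < c"
  shows "mdeg (expo b + expo c) = 2"
proof -
  have "Poly_Mapping.keys (expo b + expo c) = {b, c}"
    by (auto simp: in_keys_iff lookup_add lookup_single when_def split: if_splits)
  with assms show ?thesis
    by (simp add: mdeg_def lookup_add lookup_single when_def)
qed

lemma sqfree_deg2_iff:
  "a \<in> monomials n \<and> sqfree_monomial a \<and> mdeg a = 2 \<longleftrightarrow>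
     (\<exists>b c. 1 \<le> b \<and> b < c \<and> c \<le> n \<and> a = expo b + expo c)"
proof
  assume a: "a \<in> monomials n \<and> sqfree_monomial a \<and> mdeg a = 2"
  then have one: "Poly_Mapping.lookup a v = 1" if "v \<in> Poly_Mapping.keys a" for v
    using that by (metis in_keys_iff le_antisym less_one not_less sqfree_monomial_def)
  have zero: "Poly_Mapping.lookup a v = 0" if "v \<notin> Poly_Mapping.keys a" for v
    using that by (simp add: in_keys_iff)
  from one have "card (Poly_Mapping.keys a) = 2"
    using a by (simp add: mdeg_def)
  then obtain b c where "Poly_Mapping.keys a = {b, c}" "b < c"
    by (metis card_2_iff insert_commute linorder_neqE)
  moreover from this one have "a = expo b + expo c"
    by (intro poly_mapping_eqI) (auto simp: lookup_add lookup_single when_def zero)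
  ultimately show "\<exists>b c. 1 \<le> b \<and> b < c \<and> c \<le> n \<and> a = expo b + expo c"
    using a by (intro exI[of _ b] exI[of _ c]) (auto simp: monomials_def)
next
  assume "\<exists>b c. 1 \<le> b \<and> b < c \<and> c \<le> n \<and> a = expo b + expo c"
  then obtain b c where bc: "1 \<le> b" "b < c" "c \<le> n" "a = expo b + expo c"
    by blast
  then have "Poly_Mapping.keys a \<subseteq> {b, c}"
    by (auto simp: in_keys_iff lookup_add lookup_single when_def split: if_splits)
  moreover have "mdeg a = 2"
    unfolding bc(4) using bc(2) by (rule mdeg_expo_add)
  ultimately show "a \<in> monomials n \<and> sqfree_monomial a \<and> mdeg a = 2"
    using bc by (auto simp: monomials_def sqfree_monomial_def lookup_add lookup_single when_def)
qed

lemma revlex_greater_quadratic: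
  assumes "b < c" "i < j"
  shows "revlex_greater (expo b + expo c) (expo i + expo j) \<or> expo b + expo c = expo i + expo j
    \<longleftrightarrow> c < j \<or> c = j \<and> b \<le> i"
proof -
  let ?a = "expo b + expo c" and ?m = "expo i + expo j"
  have deg: "mdeg ?a = mdeg ?m"
    by (simp only: mdeg_expo_add[OF assms(1)] mdeg_expo_add[OF assms(2)])
  have la: "Poly_Mapping.lookup ?a v = (if v = b \<or> v = c then 1 else 0)" for v
    using assms by (auto simp: lookup_add lookup_single when_def)
  have lm: "Poly_Mapping.lookup ?m v = (if v = i \<or> v = j then 1 else 0)" for v
    using assms by (auto simp: lookup_add lookup_single when_def)
  have eq: "?a = ?m \<longleftrightarrow> b = i \<and> c = j"
  proof
    assume "?a = ?m"
    then have "Poly_Mapping.lookup ?a v = Poly_Mapping.lookup ?m v" for v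
      by (rule arg_cong)
    then have "(v = b \<or> v = c) \<longleftrightarrow> (v = i \<or> v = j)" for v
      unfolding la lm by (metis zero_neq_one)
    from this[of b] this[of c] this[of i] this[of j] show "b = i \<and> c = j"
      using assms by presburger
  next
    assume "b = i \<and> c = j"
    then show "?a = ?m" by (elim conjE) (simp only:)
  qed
  have gr: "revlex_greater ?a ?m \<longleftrightarrow> (\<exists>v. (v = i \<or> v = j) \<and> v \<noteq> b \<and> v \<noteq> c \<and>
      (\<forall>w>v. (w = b \<or> w = c) \<longleftrightarrow> (w = i \<or> w = j)))"
    (is "_ \<longleftrightarrow> (\<exists>v. ?P v)")
  proof -
    have "(if P then 1 else 0) < (if Q then 1 else (0::nat)) \<longleftrightarrow> Q \<and> \<not> P"
      "(if P then 1 else 0) = (if Q then 1 else (0::nat)) \<longleftrightarrow> (P \<longleftrightarrow> Q)" for P Q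
      by simp_all
    then show ?thesis
      unfolding revlex_greater_def la lm by (simp only: deg simp_thms conj_assoc de_Morgan_disj)
  qed
  consider "c < j" | "c = j" | "j < c"
    by linarith
  then show ?thesis
  proof cases
    case 1
    then have "?P j" using assms by auto
    then show ?thesis unfolding gr using 1 by blast
  next
    case 2
    have "?P v \<longleftrightarrow> v = i \<and> b < i" for v
    proof (cases "v = i")
      case True
      then show ?thesis using assms 2 by (cases b i rule: linorder_cases) auto
    next
      case False
      then show ?thesis using 2 by blast
    qed
    then have *: "(\<exists>v. ?P v) \<longleftrightarrow> b < i" by (simp only: simp_thms)
    show ?thesis unfolding gr eq * using 2 by auto
  next
    case 3
    have "\<not> ?P v" for v
    proof
      assume P: "?P v"
      then have "v < c" using assms 3 by auto
      with P have "c = i \<or> c = j" by blast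
      then show False using assms 3 by simp
    qed
    then have *: "(\<exists>v. ?P v) \<longleftrightarrow> False" by (simp only: simp_thms)
    show ?thesis unfolding gr eq * using 3 by auto
  qed
qed

lemma RLex_gens_quadratic:
  assumes "1 \<le> i" "i < j" "j \<le> n"
  shows "RLex_gens n (expo i + expo j) =
    {expo a + expo b | a b. 1 \<le> a \<and> a < b \<and> b \<le> j - 1} \<union> {expo a + expo j | a. 1 \<le> a \<and> a \<le> i}"
    (is "_ = ?S")
proof -
  have "x \<in> RLex_gens n (expo i + expo j) \<longleftrightarrow>
      (\<exists>b c. x = expo b + expo c \<and> 1 \<le> b \<and> b < c \<and> c \<le> n \<and> (c < j \<or> c = j \<and> b \<le> i))" for x
    using sqfree_deg2_iff[of x n] revlex_greater_quadratic[OF _ assms(2)]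
    unfolding RLex_gens_def mem_Collect_eq by metis
  moreover have "1 \<le> b \<and> b < c \<and> c \<le> n \<and> (c < j \<or> c = j \<and> b \<le> i) \<longleftrightarrow>
      (1 \<le> b \<and> b < c \<and> c \<le> j - 1) \<or> (c = j \<and> 1 \<le> b \<and> b \<le> i)" for b c
    using assms by auto
  ultimately show ?thesis
    unfolding set_eq_iff Un_iff mem_Collect_eq by (simp only: simp_thms) blast
qed

end

theory Submission
  imports Defs
begin

text \<open>
  The quotient has as basis the square-free monomials supported on the independent sets of the graph
  with edges ab (a < b < j) and aj (a \<open>\<le>\<close> i). Take for the linear form the sum of the variables. Call
  the complex of independent sets Lefschetz at N if it has no faces with more than N vertices and
  multiplication by the s-th power in degree d is injective for \<open>2 d + s \<le> N\<close> and surjective for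
  \<open>2 d + s > N\<close>. For n = j this holds with N = 2, or N = 1 if i + 1 = j, by inspection. Each variable
  beyond x_j is isolated in the graph, so it tensors the algebra with k[x]/(x^2), where
  \<open>(l + x)^s (a + x b) = l^s a + x (s l^(s-1) a + l^s b)\<close>. In characteristic zero this formula
  propagates the property from N to N + 1.
\<close>

section \<open>Lefschetz properties of cones\<close>

text \<open>Elements of degree d of the quotient in coordinates: f S is the coefficient of the
  square-free monomial of S. Forcing the value zero off the complex turns equality of elements into
  equality of functions.\<close>

definition cochains :: "'a set set \<Rightarrow> nat \<Rightarrow> ('a set \<Rightarrow> 'k::zero) set" where
  "cochains \<Delta> d = {f. \<forall>S. f S \<noteq> 0 \<longrightarrow> S \<in> \<Delta> \<and> card S = d}"

text \<open>Multiplication by the sum of the variables in these coordinates: the monomial of S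
  arises from that of each S - {v} by one factor x_v, and monomials of non-faces are zero in the
  quotient.\<close>

definition raise :: "'a set set \<Rightarrow> ('a set \<Rightarrow> 'k::comm_ring_1) \<Rightarrow> 'a set \<Rightarrow> 'k" where
  "raise \<Delta> f S = (if S \<in> \<Delta> then \<Sum>v\<in>S. f (S - {v}) else 0)"

text \<open>The condition 2 d + s \<le> N says that the midpoint of the degrees d and d + s is at
  most N / 2. Prescribing which of injectivity and surjectivity holds is stronger than full rank,
  and it is this form that passes to cones. The \<open>itself\<close> argument fixes the type of
  coefficients.\<close>

definition lefschetz_at :: "'k::comm_ring_1 itself \<Rightarrow> 'a set set \<Rightarrow> nat \<Rightarrow> bool" where
  "lefschetz_at _ \<Delta> N \<longleftrightarrow> (\<forall>S\<in>\<Delta>. card S \<le> N) \<and>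
     (\<forall>d s. 2 * d + s \<le> N \<longrightarrow>
        (\<forall>f \<in> cochains \<Delta> d. (raise \<Delta> ^^ s) f = (\<lambda>_. 0::'k) \<longrightarrow> f = (\<lambda>_. 0))) \<and>
     (\<forall>d s. N < 2 * d + s \<longrightarrow>
        (\<forall>g \<in> cochains \<Delta> (d + s). \<exists>f \<in> cochains \<Delta> d. (raise \<Delta> ^^ s) f = (g :: 'a set \<Rightarrow> 'k)))"

definition cone :: "'a \<Rightarrow> 'a set set \<Rightarrow> 'a set set" where
  "cone x \<Delta> = \<Delta> \<union> insert x ` \<Delta>"

text \<open>The element a + x b, where x is the cone point and x^2 = 0.\<close>

definition cone_join :: "'a \<Rightarrow> ('a set \<Rightarrow> 'k) \<Rightarrow> ('a set \<Rightarrow> 'k) \<Rightarrow> 'a set \<Rightarrow> 'k" where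
  "cone_join x a b S = (if x \<in> S then b (S - {x}) else a S)"

lemma raise_lincomb: "raise \<Delta> (\<lambda>S. c * f S + g S) = (\<lambda>S. c * raise \<Delta> f S + raise \<Delta> g S)"
  by (auto simp: raise_def fun_eq_iff sum.distrib sum_distrib_left)

lemma raise_pow_zero: "(raise \<Delta> ^^ s) (\<lambda>_. 0) = (\<lambda>_. 0)"
  by (induction s) (simp_all add: raise_def fun_eq_iff)

lemma raise_cochains:
  assumes "f \<in> cochains \<Delta> d" "\<And>S. S \<in> \<Delta> \<Longrightarrow> finite S"
  shows "raise \<Delta> f \<in> cochains \<Delta> (Suc d)"
proof -
  have "card S = Suc d" if "raise \<Delta> f S \<noteq> 0" for S
  proof -
    from that obtain v where "S \<in> \<Delta>" "v \<in> S" "f (S - {v}) \<noteq> 0"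
      by (auto simp: raise_def split: if_splits elim: sum.not_neutral_contains_not_neutral)
    moreover from this have "card (S - {v}) = d" using assms(1) by (simp add: cochains_def)
    ultimately show ?thesis using assms(2) card_Suc_Diff1[of S v] by simp
  qed
  then show ?thesis by (auto simp: cochains_def raise_def)
qed

lemma raise_pow_cochains:
  assumes "f \<in> cochains \<Delta> d" "\<And>S. S \<in> \<Delta> \<Longrightarrow> finite S"
  shows "(raise \<Delta> ^^ s) f \<in> cochains \<Delta> (d + s)"
  by (induction s) (use assms raise_cochains in auto)

lemma lincomb_cochains:
  assumes "f \<in> cochains \<Delta> d" "g \<in> cochains \<Delta> d"
  shows "(\<lambda>S. c * f S + g S :: 'k::comm_ring_1) \<in> cochains \<Delta> d"
proof -
  have "f S \<noteq> 0 \<or> g S \<noteq> 0" if "c * f S + g S \<noteq> 0" for S using that by auto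
  with assms show ?thesis unfolding cochains_def by blast
qed

lemma cone_join_0: "cone_join x (\<lambda>_. 0) (\<lambda>_. 0) = (\<lambda>_. 0)"
  by (auto simp: cone_join_def)

text \<open>Splitting a polynomial by divisibility by x gives a + x b with b of one degree less.
  Degree 0 leaves no room for b, hence the two clauses on d.\<close>

lemma cochains_coneE:
  fixes f :: "'a set \<Rightarrow> 'k::zero"
  assumes f: "f \<in> cochains (cone x \<Delta>) d"
    and fin: "\<And>S. S \<in> \<Delta> \<Longrightarrow> finite S" and x: "\<And>S. S \<in> \<Delta> \<Longrightarrow> x \<notin> S"
  obtains a b where "f = cone_join x a b" "a \<in> cochains \<Delta> d"
    "d = 0 \<Longrightarrow> b = (\<lambda>_. 0)" "\<And>e. d = Suc e \<Longrightarrow> b \<in> cochains \<Delta> e"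
proof
  \<comment> \<open>For S containing x, \<open>insert x S\<close> is S itself, so without the zero
    branch \<open>?b\<close> could be non-zero outside \<Delta>. \<open>cone_join\<close> never
    evaluates its two parts at such sets.\<close>
  let ?b = "\<lambda>S. if x \<in> S then 0 else f (insert x S)"
  show "f = cone_join x (\<lambda>S. if x \<in> S then 0 else f S) ?b"
    by (auto simp: cone_join_def fun_eq_iff insert_absorb)
  show "(\<lambda>S. if x \<in> S then 0 else f S) \<in> cochains \<Delta> d"
    using f by (auto simp: cochains_def cone_def split: if_splits)
  have b: "S \<in> \<Delta> \<and> Suc (card S) = d" if "?b S \<noteq> 0" for S
  proof -
    from that have xS: "x \<notin> S" "f (insert x S) \<noteq> 0" by (auto split: if_splits)
    then have "insert x S \<in> cone x \<Delta>" "card (insert x S) = d"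
      using f by (auto simp: cochains_def)
    then obtain T where "T \<in> \<Delta>" "insert x S = insert x T"
      using x unfolding cone_def by auto
    with xS x have "S \<in> \<Delta>" by (metis insert_ident)
    with xS fin \<open>card (insert x S) = d\<close> show ?thesis by auto
  qed
  show "?b = (\<lambda>_. 0)" if "d = 0" using b that by fastforce
  show "?b \<in> cochains \<Delta> e" if "d = Suc e" for e
    using b that unfolding cochains_def by blast
qed

lemma cone_join_cochains:
  assumes "a \<in> cochains \<Delta> (Suc e)" "b \<in> cochains \<Delta> e"
    and fin: "\<And>S. S \<in> \<Delta> \<Longrightarrow> finite S" and x: "\<And>S. S \<in> \<Delta> \<Longrightarrow> x \<notin> S"
  shows "cone_join x a b \<in> cochains (cone x \<Delta>) (Suc e)"
proof -
  have "S \<in> cone x \<Delta> \<and> card S = Suc e" if "cone_join x a b S \<noteq> 0" for S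
  proof (cases "x \<in> S")
    case True
    then have "S - {x} \<in> \<Delta>" "card (S - {x}) = e"
      using that assms(2) by (auto simp: cochains_def cone_join_def)
    with True show ?thesis unfolding cone_def
      using fin[of "S - {x}"] by (metis UnI2 card_Suc_Diff1 finite_Diff_insert finite.emptyI finite_Diff2 finite_insert image_eqI insert_Diff)
  next
    case False
    then show ?thesis using that assms(1) by (auto simp: cochains_def cone_join_def cone_def)
  qed
  then show ?thesis by (auto simp: cochains_def)
qed

text \<open>This is (l + x) (a + x b) = l a + x (a + l b), where x^2 = 0 removes the term with x
  b.\<close>

lemma raise_cone_join:
  assumes a: "a \<in> cochains \<Delta> d" and b: "\<And>S. b S \<noteq> 0 \<Longrightarrow> S \<in> \<Delta>"
    and fin: "\<And>S. S \<in> \<Delta> \<Longrightarrow> finite S" and x: "\<And>S. S \<in> \<Delta> \<Longrightarrow> x \<notin> S"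
  shows "raise (cone x \<Delta>) (cone_join x a b) = cone_join x (raise \<Delta> a) (\<lambda>S. a S + raise \<Delta> b S)"
proof
  fix S
  show "raise (cone x \<Delta>) (cone_join x a b) S = cone_join x (raise \<Delta> a) (\<lambda>S. a S + raise \<Delta> b S) S"
  proof (cases "x \<in> S")
    case True
    then have iff: "S \<in> cone x \<Delta> \<longleftrightarrow> S - {x} \<in> \<Delta>"
      unfolding cone_def using x by (auto simp: image_iff)
    \<comment> \<open>Removing x from S lands in the part a; removing any other vertex keeps x and
      lands in the part b.\<close>
    have *: "(\<Sum>v\<in>S. cone_join x a b (S - {v})) = a (S - {x}) + (\<Sum>v\<in>S - {x}. b (S - {x} - {v}))"
      if "finite S"
    proof -
      have "(\<Sum>v\<in>S. cone_join x a b (S - {v}))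
          = cone_join x a b (S - {x}) + (\<Sum>v\<in>S - {x}. cone_join x a b (S - {v}))"
        using that True by (rule sum.remove)
      also have "(\<Sum>v\<in>S - {x}. cone_join x a b (S - {v})) = (\<Sum>v\<in>S - {x}. b (S - {x} - {v}))"
      proof (rule sum.cong)
        fix v assume "v \<in> S - {x}"
        moreover have "S - {v} - {x} = S - {x} - {v}" by blast
        ultimately show "cone_join x a b (S - {v}) = b (S - {x} - {v})"
          using True by (auto simp: cone_join_def)
      qed simp
      finally show ?thesis by (simp add: cone_join_def)
    qed
    show ?thesis
    proof (cases "S - {x} \<in> \<Delta>")
      case T: True
      then have "finite S" using fin[OF T] by simp
      from *[OF this] True T iff show ?thesis by (simp add: raise_def cone_join_def)
    next
      case False
      \<comment> \<open>Off the cone the left side is zero by definition, but on the right the bare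
        summand a has to vanish by its own support.\<close>
      then have "a (S - {x}) = 0" using a by (auto simp: cochains_def)
      with False True iff show ?thesis by (simp add: raise_def cone_join_def)
    qed
  next
    case False
    then have "S \<in> cone x \<Delta> \<longleftrightarrow> S \<in> \<Delta>" by (auto simp: cone_def)
    with False show ?thesis by (auto simp: raise_def cone_join_def)
  qed
qed

text \<open>Each further factor l + x adds one more copy of l^s a to the part divisible by x. For s
  = 0 the truncated exponent s - 1 is harmless, being multiplied by \<open>of_nat 0\<close>.\<close>

lemma raise_pow_cone_join:
  assumes a: "a \<in> cochains \<Delta> d" and b: "\<And>S. b S \<noteq> 0 \<Longrightarrow> S \<in> \<Delta>"
    and fin: "\<And>S. S \<in> \<Delta> \<Longrightarrow> finite S" and x: "\<And>S. S \<in> \<Delta> \<Longrightarrow> x \<notin> S"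
  shows "(raise (cone x \<Delta>) ^^ s) (cone_join x a b) = cone_join x ((raise \<Delta> ^^ s) a)
    (\<lambda>S. of_nat s * (raise \<Delta> ^^ (s - 1)) a S + (raise \<Delta> ^^ s) b S)"
proof (induction s)
  case 0
  then show ?case by simp
next
  case (Suc s)
  let ?c = "\<lambda>S. of_nat s * (raise \<Delta> ^^ (s - 1)) a S + (raise \<Delta> ^^ s) b S"
  have supp: "(raise \<Delta> ^^ t) g S \<noteq> 0 \<Longrightarrow> S \<in> \<Delta>" if "\<And>S. g S \<noteq> 0 \<Longrightarrow> S \<in> \<Delta>" for t g S
    using that by (cases t) (auto simp: raise_def split: if_splits)
  have "?c S \<noteq> 0 \<Longrightarrow> S \<in> \<Delta>" for S
    using supp[of a "s - 1" S] supp[of b s S] a b by (fastforce simp: cochains_def)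
  then have "(raise (cone x \<Delta>) ^^ Suc s) (cone_join x a b) =
      cone_join x (raise \<Delta> ((raise \<Delta> ^^ s) a)) (\<lambda>S. (raise \<Delta> ^^ s) a S + raise \<Delta> ?c S)"
    using raise_cone_join[OF raise_pow_cochains[OF a fin] _ fin x] Suc by simp
  also have "raise \<Delta> ?c = (\<lambda>S. of_nat s * (raise \<Delta> ^^ s) a S + (raise \<Delta> ^^ Suc s) b S)"
    unfolding raise_lincomb by (cases s) simp_all
  finally show ?case by (simp add: algebra_simps)
qed

text \<open>\<open>cone_join\<close> does not see the values of a and b at sets containing x, so the
  support conditions have to supply their vanishing there.\<close>

lemma cone_join_eq_0D:
  assumes "cone_join x a b = (\<lambda>_. 0)" "\<And>S. a S \<noteq> 0 \<Longrightarrow> x \<notin> S" "\<And>S. b S \<noteq> 0 \<Longrightarrow> x \<notin> S"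
  shows "a = (\<lambda>_. 0)" "b = (\<lambda>_. 0)"
proof -
  have *: "cone_join x a b S = 0" for S using assms(1) by simp
  show "a = (\<lambda>_. 0)"
    using assms(2) * unfolding fun_eq_iff cone_join_def by metis
  have "b S = 0" if "x \<notin> S" for S using *[of "insert x S"] that by (simp add: cone_join_def)
  then show "b = (\<lambda>_. 0)" using assms(3) by auto
qed

text \<open>The image of a + x b under (l + x)^s is p + x q exactly if l^s a = p and s l^(s-1) a +
  l^s b = q. Eliminating a leaves an equation for l^(s+1) b with b in degree d - 1; afterwards a is
  governed by l^(s-1) in degree d. Both 2 (d - 1) + (s + 1) and 2 d + (s - 1) equal 2 d + s - 1, so
  the bound N + 1 for the cone becomes the bound N for the base. Division by s uses characteristic
  zero.\<close>

lemma lefschetz_at_cone: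
  fixes \<Delta> :: "'a set set"
  assumes lef: "lefschetz_at TYPE('k::field_char_0) \<Delta> N"
    and fin: "\<And>S. S \<in> \<Delta> \<Longrightarrow> finite S" and x: "\<And>S. S \<in> \<Delta> \<Longrightarrow> x \<notin> S"
  shows "lefschetz_at TYPE('k) (cone x \<Delta>) (Suc N)"
  unfolding lefschetz_at_def
proof (intro conjI allI impI ballI)
  let ?L = "raise \<Delta> :: ('a set \<Rightarrow> 'k) \<Rightarrow> _"
  have card: "card S \<le> N" if "S \<in> \<Delta>" for S using lef that by (simp add: lefschetz_at_def)
  have inj: "f = (\<lambda>_. 0)" if "2 * d + s \<le> N" "f \<in> cochains \<Delta> d" "(?L ^^ s) f = (\<lambda>_. 0)" for f d s
    using lef that unfolding lefschetz_at_def by blast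
  have surj: "\<exists>f \<in> cochains \<Delta> d. (?L ^^ s) f = g" if "N < 2 * d + s" "g \<in> cochains \<Delta> (d + s)" for g d s
    using lef that unfolding lefschetz_at_def by blast
  note pow = raise_pow_cone_join[OF _ _ fin x]
  show card': "card S \<le> Suc N" if "S \<in> cone x \<Delta>" for S
    using that card fin x by (force simp: cone_def)
  {
    fix d s and f :: "'a set \<Rightarrow> 'k"
    assume ds: "2 * d + s \<le> Suc N" and f: "f \<in> cochains (cone x \<Delta>) d"
      and f0: "(raise (cone x \<Delta>) ^^ s) f = (\<lambda>_. 0)"
    show "f = (\<lambda>_. 0)"
    proof (cases s)
      case 0
      then show ?thesis using f0 by simp
    next
      case (Suc t)
      obtain a b where ab: "f = cone_join x a b" "a \<in> cochains \<Delta> d"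
        "d = 0 \<Longrightarrow> b = (\<lambda>_. 0)" "\<And>e. d = Suc e \<Longrightarrow> b \<in> cochains \<Delta> e"
        using cochains_coneE[OF f fin x] by metis
      have bsupp: "S \<in> \<Delta>" if "b S \<noteq> 0" for S
        using ab that by (cases d) (auto simp: cochains_def)
      have supp: "(?L ^^ t) g S \<noteq> 0 \<Longrightarrow> S \<in> \<Delta>" if "\<And>S. g S \<noteq> 0 \<Longrightarrow> S \<in> \<Delta>" for t g S
        using that by (cases t) (auto simp: raise_def split: if_splits)
      have asupp: "S \<in> \<Delta>" if "a S \<noteq> 0" for S using ab that by (auto simp: cochains_def)
      let ?c = "\<lambda>S. of_nat s * (?L ^^ t) a S + (?L ^^ s) b S"
      have "cone_join x ((?L ^^ s) a) ?c = (\<lambda>_. 0)"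
        using f0 pow[OF ab(2) bsupp, where s=s] ab(1) Suc by simp
      moreover have "?c S \<noteq> 0 \<Longrightarrow> x \<notin> S" for S
        using supp[of a t S] supp[of b s S] asupp bsupp x by fastforce
      moreover have "(?L ^^ s) a S \<noteq> 0 \<Longrightarrow> x \<notin> S" for S
        using supp[of a s S] asupp x by fastforce
      ultimately have a0: "(?L ^^ s) a = (\<lambda>_. 0)" and c0: "?c = (\<lambda>_. 0)"
        by (blast dest: cone_join_eq_0D)+
      \<comment> \<open>Here p = q = 0. Applying l to the equation for q gives s l^s a + l^(s+1) b =
        0, whose first term is already known to vanish.\<close>
      have "(\<lambda>S. of_nat s * (?L ^^ s) a S + (?L ^^ Suc s) b S) = ?L ?c"
        unfolding raise_lincomb using Suc by simp
      also have "\<dots> = (\<lambda>_. 0)" unfolding c0 by (simp add: raise_def fun_eq_iff)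
      finally have "(?L ^^ Suc s) b = (\<lambda>_. 0)" unfolding a0 by simp
      then have b0: "b = (\<lambda>_. 0)"
        using ab(3,4) ds inj[of "d - 1" "Suc s" b] by (cases d) auto
      \<comment> \<open>With b = 0 the equation for q reads s l^t a = 0, where t = s - 1 and s is
        invertible.\<close>
      have "(?L ^^ t) a = (\<lambda>_. 0)"
        using c0 Suc unfolding b0 raise_pow_zero fun_eq_iff by (simp del: of_nat_Suc)
      then have "a = (\<lambda>_. 0)" using inj[of d t a] ab(2) ds Suc by simp
      with b0 ab(1) show ?thesis by (simp add: cone_join_0)
    qed
  next
    fix d s and g :: "'a set \<Rightarrow> 'k"
    assume ds: "Suc N < 2 * d + s" and g: "g \<in> cochains (cone x \<Delta>) (d + s)"
    show "\<exists>f \<in> cochains (cone x \<Delta>) d. (raise (cone x \<Delta>) ^^ s) f = g"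
    proof (cases "s = 0")
      case True
      then show ?thesis using g by auto
    next
      case False
      then obtain t where t: "s = Suc t" by (cases s) auto
      show ?thesis
      proof (cases d)
        case 0
        \<comment> \<open>Now s > N + 1, so the target lies in a degree in which the cone has no
          faces.\<close>
        have "g = (\<lambda>_. 0)"
        proof (rule ccontr)
          assume "g \<noteq> (\<lambda>_. 0)"
          then obtain S where "g S \<noteq> 0" by auto
          with g card' 0 ds show False by (fastforce simp: cochains_def)
        qed
        then show ?thesis
          by (intro bexI[of _ "\<lambda>_. 0"]) (simp_all add: raise_pow_zero cochains_def)
      next
        case (Suc e)
        have [simp]: "d + s = Suc (e + s)" using Suc by simp
        obtain p q where pq: "g = cone_join x p q" "p \<in> cochains \<Delta> (d + s)" "q \<in> cochains \<Delta> (e + s)"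
          using cochains_coneE[OF g fin x] by (metis \<open>d + s = Suc (e + s)\<close>)
        \<comment> \<open>The elimination of a: l q - l^(s+1) b has to equal s p, so l^(s+1) b must
          be l q - s p.\<close>
        have "(\<lambda>S. - of_nat s * p S + ?L q S) \<in> cochains \<Delta> (e + Suc s)"
          using lincomb_cochains[of p \<Delta> "e + Suc s" "raise \<Delta> q" "- of_nat s"] raise_cochains[OF pq(3) fin] pq(2) by simp
        from surj[OF _ this] obtain b where
          b: "b \<in> cochains \<Delta> e" "(?L ^^ Suc s) b = (\<lambda>S. - of_nat s * p S + ?L q S)"
          using ds Suc by auto
        \<comment> \<open>This is q - l^s b, the value that s l^(s-1) a has to take.\<close>
        let ?h = "\<lambda>S. (-1) * (?L ^^ s) b S + q S"
        have "?h \<in> cochains \<Delta> (d + t)"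
          using lincomb_cochains[OF raise_pow_cochains[OF b(1) fin] pq(3), of "-1"] t Suc by simp
        then have "(\<lambda>S. inverse (of_nat s) * ?h S) \<in> cochains \<Delta> (d + t)"
          by (auto simp: cochains_def)
        from surj[OF _ this] obtain a where
          a: "a \<in> cochains \<Delta> d" "(?L ^^ t) a = (\<lambda>S. inverse (of_nat s) * ?h S)"
          using ds t by auto
        have sne: "(of_nat s :: 'k) \<noteq> 0" using t by (simp del: of_nat_Suc)
        have e1: "(\<lambda>S. of_nat s * (?L ^^ t) a S + (?L ^^ s) b S) = q"
          using sne unfolding a(2) by (simp add: fun_eq_iff field_simps)
        \<comment> \<open>The equation for p now follows, since l applied to \<open>?h\<close> is l
          q - l^(s+1) b = s p by the choice of b. The summand 0 brings the expression into the shape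
          of \<open>raise_lincomb\<close>.\<close>
        have "(?L ^^ s) a = ?L (\<lambda>S. inverse (of_nat s) * ?h S + 0)"
          using a(2) t by simp
        also have "\<dots> = (\<lambda>S. inverse (of_nat s) * ?L ?h S + ?L (\<lambda>_. 0) S)"
          by (rule raise_lincomb)
        also have "?L ?h = (\<lambda>S. of_nat s * p S)"
          unfolding raise_lincomb using b(2) by (simp add: fun_eq_iff)
        also have "(\<lambda>S. inverse (of_nat s) * (of_nat s * p S) + ?L (\<lambda>_. 0) S) = p"
          using sne by (simp add: raise_def fun_eq_iff)
        finally have e2: "(?L ^^ s) a = p" .
        have bs: "\<And>S. b S \<noteq> 0 \<Longrightarrow> S \<in> \<Delta>" using b(1) by (auto simp: cochains_def)
        have "(raise (cone x \<Delta>) ^^ s) (cone_join x a b) = g"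
          using pow[OF a(1) bs, where s=s] e1 e2 pq(1) t by simp
        moreover have "cone_join x a b \<in> cochains (cone x \<Delta>) d"
          using cone_join_cochains[OF _ b(1) fin x] a(1) Suc by simp
        ultimately show ?thesis by blast
      qed
    qed
  }
qed

section \<open>The independence complex\<close>

text \<open>The forbidden pairs are those whose monomials generate RLex(x_i x_j). Keeping n separate
  from j allows induction on the number of isolated vertices.\<close>

definition faces :: "nat \<Rightarrow> nat \<Rightarrow> nat \<Rightarrow> nat set set" where
  "faces i j n = {S. S \<subseteq> {1..n} \<and> (\<forall>a\<in>S. \<forall>b\<in>S. a < b \<longrightarrow> \<not> (b < j \<or> b = j \<and> a \<le> i))}"

lemma faces_finite: "S \<in> faces i j n \<Longrightarrow> finite S"
  by (auto simp: faces_def intro: finite_subset)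

lemma faces_mono: "S \<in> faces i j n \<Longrightarrow> T \<subseteq> S \<Longrightarrow> T \<in> faces i j n"
  by (auto simp: faces_def)

text \<open>The new vertex exceeds j and therefore belongs to no forbidden pair.\<close>

lemma faces_Suc:
  assumes "j \<le> n"
  shows "faces i j (Suc n) = cone (Suc n) (faces i j n)"
proof -
  have "S \<in> faces i j (Suc n) \<longleftrightarrow> S \<in> cone (Suc n) (faces i j n)" for S
  proof (cases "Suc n \<in> S")
    case True
    then obtain T where T: "S = insert (Suc n) T" "Suc n \<notin> T" by (metis mk_disjoint_insert)
    have "S \<in> cone (Suc n) (faces i j n) \<longleftrightarrow> T \<in> faces i j n"
      using T unfolding cone_def faces_def image_iff
      by (auto simp: subset_insert_iff dest!: insert_ident[THEN iffD1, rotated 2])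
    moreover have "S \<in> faces i j (Suc n) \<longleftrightarrow> T \<in> faces i j n"
      unfolding T(1) faces_def using T(2) assms by (force simp: atLeastAtMostSuc_conv)
    ultimately show ?thesis by simp
  next
    case False
    then show ?thesis by (auto simp: cone_def faces_def atLeastAtMostSuc_conv)
  qed
  then show ?thesis by blast
qed

text \<open>A pair a < b inside a face must have b = j and i < a. The complex is thus a star with
  centre j and leaves i + 1, ..., j - 1, together with the isolated points 1, ..., i.\<close>

lemma faces_base:
  assumes "i < j"
  shows "S \<in> faces i j j \<longleftrightarrow> S = {} \<or> (\<exists>v\<in>{1..j}. S = {v}) \<or> (\<exists>v. i < v \<and> v < j \<and> S = {v, j})"
    (is "_ \<longleftrightarrow> ?R")
proof
  assume S: "S \<in> faces i j j"
  have edge: "b = j \<and> i < a" if "a \<in> S" "b \<in> S" "a < b" for a b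
    using S that by (force simp: faces_def)
  have sub: "S \<subseteq> {1..j}" using S by (simp add: faces_def)
  show ?R
  proof (cases "\<exists>a\<in>S. \<exists>b\<in>S. a < b")
    case True
    then obtain a where a: "a \<in> S" "j \<in> S" "a < j" "i < a" using edge by metis
    \<comment> \<open>A vertex c > a must be j, and c < a would force a = j.\<close>
    have "c = a \<or> c = j" if "c \<in> S" for c
      using edge[of a c] edge[of c a] a that by (cases a c rule: linorder_cases) auto
    then have "S = {a, j}" using a by blast
    then show ?thesis using a by blast
  next
    case False
    then have "a = b" if "a \<in> S" "b \<in> S" for a b using that by (meson linorder_neqE)
    then show ?thesis using sub by (cases "S = {}") blast+
  qed
next
  assume ?R
  then show "S \<in> faces i j j" using assms by (auto simp: faces_def)
qed

section \<open>The Lefschetz property for n = j and its extension to larger n\<close>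

lemma cochains_eq_0:
  assumes "f \<in> cochains \<Delta> d" "\<And>S. S \<in> \<Delta> \<Longrightarrow> card S < d"
  shows "f = (\<lambda>_. 0)"
  using assms by (fastforce simp: cochains_def)

text \<open>For s > 0, injectivity is asked only for d = 0, and surjectivity has zero targets except
  possibly for d = s = 1. If i + 1 = j, there is no face with two vertices; then l^2 kills degree 0,
  which is why N drops to 1.\<close>

lemma lefschetz_at_base:
  assumes "1 \<le> i" "i < j"
  shows "lefschetz_at TYPE('k::field_char_0) (faces i j j) (if Suc i < j then 2 else 1)"
  unfolding lefschetz_at_def
proof (intro conjI allI impI ballI)
  let ?\<Delta> = "faces i j j" and ?N = "if Suc i < j then 2 else 1 :: nat"
  note base = faces_base[OF assms(2)]
  have sing: "{v} \<in> ?\<Delta>" if "v \<in> {1..j}" for v using that base by blast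
  have pair: "{v, j} \<in> ?\<Delta>" if "i < v" "v < j" for v using that base by blast
  show card: "card S \<le> ?N" if "S \<in> ?\<Delta>" for S
    using that unfolding base by (auto simp: card_insert_if)
  {
    fix d s and f :: "nat set \<Rightarrow> 'k"
    assume ds: "2 * d + s \<le> ?N" and f: "f \<in> cochains ?\<Delta> d"
      and f0: "(raise ?\<Delta> ^^ s) f = (\<lambda>_. 0)"
    show "f = (\<lambda>_. 0)"
    proof (cases "s = 0")
      case True
      then show ?thesis using f0 by simp
    next
      case False
      with ds have d: "d = 0" by (simp split: if_splits)
      have single: "raise ?\<Delta> f {v} = f {}" if "v \<in> {1..j}" for v
        using sing[OF that] by (simp add: raise_def)
      have "f {} = 0"
      proof (cases "s = 1")
        case True
        have "f {} = raise ?\<Delta> f {j}" using single[of j] assms by simp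
        also have "\<dots> = 0" using f0 True by simp
        finally show ?thesis .
      next
        case s: False
        with False ds have s: "s = Suc (Suc 0)" and j: "Suc i < j" by (auto split: if_splits)
        \<comment> \<open>The coefficient of l^2 f at the face {i + 1, j} is 2 f {}, one summand for
          each order of its vertices. Characteristic zero cancels the 2.\<close>
        have "0 = (raise ?\<Delta> ^^ s) f {Suc i, j}" using f0 by simp
        also have "\<dots> = raise ?\<Delta> f ({Suc i, j} - {Suc i}) + raise ?\<Delta> f ({Suc i, j} - {j})"
          using pair[of "Suc i"] j unfolding s by (simp add: raise_def[of _ "raise ?\<Delta> f"])
        also have "{Suc i, j} - {Suc i} = {j}" using j by auto
        also have "{Suc i, j} - {j} = {Suc i}" using j by auto
        also have "raise ?\<Delta> f {j} + raise ?\<Delta> f {Suc i} = 2 * f {}"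
          using single[of j] single[of "Suc i"] j by simp
        finally show ?thesis by simp
      qed
      moreover have "f S = 0" if "S \<noteq> {}" for S
        using f that d faces_finite by (force simp: cochains_def)
      ultimately show ?thesis by (metis ext)
    qed
  next
    fix d s and g :: "nat set \<Rightarrow> 'k"
    assume ds: "?N < 2 * d + s" and g: "g \<in> cochains ?\<Delta> (d + s)"
    consider "s = 0" | "?N < d + s" | "s = 1" "d = 1"
      using ds by (auto split: if_splits) linarith+
    then show "\<exists>f \<in> cochains ?\<Delta> d. (raise ?\<Delta> ^^ s) f = g"
    proof cases
      case 1
      then show ?thesis using g by auto
    next
      case 2
      have "g = (\<lambda>_. 0)" using cochains_eq_0[OF g] card 2 by (meson le_less_trans)
      then show ?thesis by (intro bexI[of _ "\<lambda>_. 0"]) (simp_all add: raise_pow_zero cochains_def)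
    next
      case 3
      \<comment> \<open>The preimage puts the coefficient of {v, j} on the leaf v and zero on the
        centre j, so that in the image only the removal of j contributes.\<close>
      let ?f = "\<lambda>S. if \<exists>v. i < v \<and> v < j \<and> S = {v} then g (insert j S) else 0"
      have "?f \<in> cochains ?\<Delta> d" using 3 sing by (auto simp: cochains_def)
      moreover have "raise ?\<Delta> ?f = g"
      proof
        fix S
        show "raise ?\<Delta> ?f S = g S"
        proof (cases "\<exists>v. i < v \<and> v < j \<and> S = {v, j}")
          case True
          then obtain v where v: "i < v" "v < j" "S = {v, j}" by blast
          then have "S - {v} = {j}" "S - {j} = {v}" by auto
          then show ?thesis
            using v pair[of v] by (simp add: raise_def insert_commute)
        next
          case False
          have "g S = 0"
          proof (rule ccontr)
            assume "g S \<noteq> 0"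
            then have "S \<in> ?\<Delta>" "card S = 2" using g 3 by (auto simp: cochains_def)
            with False base show False by auto
          qed
          moreover have "raise ?\<Delta> ?f S = 0"
            using False base[of S] by (auto simp: raise_def)
          ultimately show ?thesis by simp
        qed
      qed
      ultimately show ?thesis using 3 by auto
    qed
  }
qed

text \<open>Induction from n = j: every further vertex is a cone point and raises N by one.\<close>

lemma lefschetz_at_faces:
  assumes "1 \<le> i" "i < j" "j \<le> n"
  shows "\<exists>N. lefschetz_at TYPE('k::field_char_0) (faces i j n) N"
  using assms(3)
proof (induction n rule: dec_induct)
  case base
  show ?case using lefschetz_at_base[OF assms(1,2)] by blast
next
  case (step n)
  then obtain N where "lefschetz_at TYPE('k) (faces i j n) N" by blast
  then have "lefschetz_at TYPE('k) (cone (Suc n) (faces i j n)) (Suc N)"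
    by (rule lefschetz_at_cone) (auto simp: faces_def intro: finite_subset)
  then show ?case using faces_Suc[OF step(1)] by metis
qed

section \<open>Square-free coefficients of polynomials\<close>

definition sqfree_mon :: "nat set \<Rightarrow> monomial" where
  "sqfree_mon S = (\<Sum>v\<in>S. expo v)"

text \<open>Coordinates on the quotient: on the polynomial ring, the kernel of this map will turn
  out to be the defining ideal.\<close>

definition face_coeffs :: "nat set set \<Rightarrow> 'k::comm_ring_1 polynomial \<Rightarrow> nat set \<Rightarrow> 'k" where
  "face_coeffs \<Delta> p S = (if S \<in> \<Delta> then Poly_Mapping.lookup p (sqfree_mon S) else 0)"

lemma lookup_sqfree_mon:
  "finite S \<Longrightarrow> Poly_Mapping.lookup (sqfree_mon S) v = (if v \<in> S then 1 else 0)"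
  by (simp add: sqfree_mon_def lookup_sum lookup_single when_def)

lemma keys_sqfree_mon: "finite S \<Longrightarrow> Poly_Mapping.keys (sqfree_mon S) = S"
  by (auto simp: in_keys_iff lookup_sqfree_mon split: if_splits)

lemma mdeg_sqfree_mon: "finite S \<Longrightarrow> mdeg (sqfree_mon S) = card S"
  by (simp add: mdeg_def keys_sqfree_mon lookup_sqfree_mon)

lemma sqfree_mon_inject: "finite S \<Longrightarrow> finite T \<Longrightarrow> sqfree_mon S = sqfree_mon T \<longleftrightarrow> S = T"
  using keys_sqfree_mon by metis

lemma sqfree_mon_keys: "sqfree_monomial a \<Longrightarrow> sqfree_mon (Poly_Mapping.keys a) = a"
  by (intro poly_mapping_eqI)
    (metis finite_keys in_keys_iff le_antisym less_one linorder_not_less lookup_sqfree_mon sqfree_monomial_def)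

lemma sqfree_mon_insert: "finite S \<Longrightarrow> v \<notin> S \<Longrightarrow> sqfree_mon (insert v S) = expo v + sqfree_mon S"
  by (simp add: sqfree_mon_def)

lemma lookup_single_times:
  fixes a b :: monomial
  shows "Poly_Mapping.lookup (Poly_Mapping.single a c * p) (a + b) = c * Poly_Mapping.lookup p b"
  by (simp add: lookup_mult lookup_single when_mult)

text \<open>Every monomial of the product is divisible by x_v, and dividing the monomial of S by x_v
  removes v from S.\<close>

lemma lookup_var_times:
  assumes "finite S"
  shows "Poly_Mapping.lookup (var v * p) (sqfree_mon S) =
    (if v \<in> S then Poly_Mapping.lookup p (sqfree_mon (S - {v})) else 0)"
proof (cases "v \<in> S")
  case True
  then have "sqfree_mon S = expo v + sqfree_mon (S - {v})"
    using sqfree_mon_insert[of "S - {v}" v] assms by (simp add: insert_absorb)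
  with True show ?thesis by (simp add: var_def mono_poly_def lookup_single_times)
next
  case False
  have "sqfree_mon S \<notin> Poly_Mapping.keys (var v * p)"
  proof
    assume "sqfree_mon S \<in> Poly_Mapping.keys (var v * p)"
    then obtain a b where "a \<in> Poly_Mapping.keys (var v :: 'a polynomial)" "sqfree_mon S = a + b"
      using keys_mult by fastforce
    then have "sqfree_mon S = expo v + b"
      by (auto simp: var_def mono_poly_def split: if_splits)
    then have "Poly_Mapping.lookup (sqfree_mon S) v \<noteq> 0" by (simp add: lookup_add)
    with False assms show False by (simp add: lookup_sqfree_mon)
  qed
  with False show ?thesis by (simp add: in_keys_iff)
qed

text \<open>This identifies \<open>raise\<close> with multiplication by the linear form. Downward
  closure ensures that each S - {v} is again a face, so that no coefficient of p is cut off.\<close>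

lemma face_coeffs_linear_form_times:
  assumes "\<And>S. S \<in> \<Delta> \<Longrightarrow> S \<subseteq> {1..n}" "\<And>S T. S \<in> \<Delta> \<Longrightarrow> T \<subseteq> S \<Longrightarrow> T \<in> \<Delta>"
  shows "face_coeffs \<Delta> ((\<Sum>v\<in>{1..n}. var v) * p) = raise \<Delta> (face_coeffs \<Delta> p)"
proof
  fix S
  show "face_coeffs \<Delta> ((\<Sum>v\<in>{1..n}. var v) * p) S = raise \<Delta> (face_coeffs \<Delta> p) S"
  proof (cases "S \<in> \<Delta>")
    case True
    then have S: "S \<subseteq> {1..n}" "finite S" using assms(1) finite_subset by blast+
    have "face_coeffs \<Delta> ((\<Sum>v\<in>{1..n}. var v) * p) S =
        (\<Sum>v\<in>{1..n}. if v \<in> S then Poly_Mapping.lookup p (sqfree_mon (S - {v})) else 0)"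
      using True S(2) by (simp add: face_coeffs_def sum_distrib_right lookup_sum lookup_var_times)
    also have "\<dots> = (\<Sum>v\<in>S. Poly_Mapping.lookup p (sqfree_mon (S - {v})))"
      using S by (simp add: sum.If_cases Int_absorb1)
    also have "\<dots> = (\<Sum>v\<in>S. face_coeffs \<Delta> p (S - {v}))"
      using assms(2)[OF True] by (intro sum.cong) (auto simp: face_coeffs_def)
    finally show ?thesis using True by (simp add: raise_def)
  qed (simp add: face_coeffs_def raise_def)
qed

lemma face_coeffs_linear_form_pow_times:
  assumes "\<And>S. S \<in> \<Delta> \<Longrightarrow> S \<subseteq> {1..n}" "\<And>S T. S \<in> \<Delta> \<Longrightarrow> T \<subseteq> S \<Longrightarrow> T \<in> \<Delta>"
  shows "face_coeffs \<Delta> ((\<Sum>v\<in>{1..n}. var v) ^ s * p) = (raise \<Delta> ^^ s) (face_coeffs \<Delta> p)"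
  by (induction s) (simp_all only: power_Suc mult.assoc face_coeffs_linear_form_times[OF assms]
      power_0 mult_1_left funpow.simps id_apply o_apply)

lemma face_coeffs_cochains:
  assumes "p \<in> forms n d" "\<And>S. S \<in> \<Delta> \<Longrightarrow> finite S"
  shows "face_coeffs \<Delta> p \<in> cochains \<Delta> d"
proof -
  have "card S = d" if "S \<in> \<Delta>" "Poly_Mapping.lookup p (sqfree_mon S) \<noteq> 0" for S
  proof -
    from that(2) have "sqfree_mon S \<in> Poly_Mapping.keys p" by (simp add: in_keys_iff)
    with assms(1) show ?thesis
      using mdeg_sqfree_mon[OF assms(2)[OF that(1)]] by (auto simp: forms_def)
  qed
  then show ?thesis by (auto simp: cochains_def face_coeffs_def split: if_splits)
qed

lemma face_coeffs_surj:
  assumes "f \<in> cochains \<Delta> d" "finite \<Delta>" "\<And>S. S \<in> \<Delta> \<Longrightarrow> S \<subseteq> {1..n}"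
  shows "\<exists>p \<in> forms n d. face_coeffs \<Delta> p = f"
proof
  let ?p = "\<Sum>S\<in>\<Delta>. Poly_Mapping.single (sqfree_mon S) (f S)"
  have fin: "finite S" if "S \<in> \<Delta>" for S using assms(3)[OF that] finite_subset by blast
  have f: "f S \<noteq> 0 \<Longrightarrow> S \<in> \<Delta> \<and> card S = d" for S using assms(1) by (simp add: cochains_def)
  have lookup: "Poly_Mapping.lookup ?p a = (\<Sum>S\<in>\<Delta>. if sqfree_mon S = a then f S else 0)" for a
    by (simp add: lookup_sum lookup_single when_def)
  have "a \<in> monomials n \<and> mdeg a = d" if "a \<in> Poly_Mapping.keys ?p" for a
  proof -
    from that have "(\<Sum>S\<in>\<Delta>. if sqfree_mon S = a then f S else 0) \<noteq> 0"
      by (simp add: in_keys_iff lookup)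
    then obtain S where "S \<in> \<Delta>" "sqfree_mon S = a" "f S \<noteq> 0"
      by (auto elim: sum.not_neutral_contains_not_neutral split: if_splits)
    with fin[of S] assms(3)[of S] f[of S] show ?thesis
      unfolding monomials_def by (auto simp: keys_sqfree_mon mdeg_sqfree_mon)
  qed
  then show "?p \<in> forms n d" by (auto simp: forms_def poly_ring_def)
  show "face_coeffs \<Delta> ?p = f"
  proof
    fix S
    show "face_coeffs \<Delta> ?p S = f S"
    proof (cases "S \<in> \<Delta>")
      case True
      have "Poly_Mapping.lookup ?p (sqfree_mon S) = (\<Sum>T\<in>\<Delta>. if T = S then f T else 0)"
        unfolding lookup using fin True by (intro sum.cong) (auto simp: sqfree_mon_inject)
      with True assms(2) show ?thesis by (simp add: face_coeffs_def)
    next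
      case False
      then show ?thesis using f by (auto simp: face_coeffs_def)
    qed
  qed
qed

lemma face_coeffs_diff: "face_coeffs \<Delta> (p - q) = (\<lambda>S. (-1) * face_coeffs \<Delta> q S + face_coeffs \<Delta> p S)"
  by (auto simp: face_coeffs_def lookup_minus)

section \<open>Homogeneous forms and their products\<close>

lemma forms_diff: "p \<in> forms n d \<Longrightarrow> q \<in> forms n d \<Longrightarrow> p - q \<in> forms n d"
  using keys_diff[of p q] by (fastforce simp: forms_def poly_ring_def)

lemma sum_vars_form: "(\<Sum>v\<in>{1..n}. var v) \<in> (forms n 1 :: 'k::comm_ring_1 polynomial set)"
proof -
  have "a \<in> monomials n \<and> mdeg a = 1" if "a \<in> Poly_Mapping.keys (\<Sum>v\<in>{1..n}. var v :: 'k polynomial)" for a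
  proof -
    from that obtain v where v: "v \<in> {1..n}" "a \<in> Poly_Mapping.keys (var v :: 'k polynomial)"
      using keys_sum[of "var :: nat \<Rightarrow> 'k polynomial" "{1..n}"] by blast
    then have "a = expo v" by (auto simp: var_def mono_poly_def split: if_splits)
    with v show ?thesis by (auto simp: monomials_def mdeg_def)
  qed
  then show ?thesis by (auto simp: forms_def poly_ring_def)
qed

lemma mdeg_add: "mdeg (a + b) = mdeg a + mdeg b"
proof -
  let ?K = "Poly_Mapping.keys a \<union> Poly_Mapping.keys b"
  have *: "mdeg c = (\<Sum>v\<in>?K. Poly_Mapping.lookup c v)" if "Poly_Mapping.keys c \<subseteq> ?K" for c
    unfolding mdeg_def using that by (intro sum.mono_neutral_left) (auto simp: in_keys_iff)
  show ?thesis
    using *[of a] *[of b] *[of "a + b"] keys_add[of a b] by (simp add: lookup_add sum.distrib)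
qed

lemma forms_times:
  assumes "p \<in> forms n d" "q \<in> forms n e"
  shows "p * q \<in> forms n (d + e)"
proof -
  have "a \<in> monomials n \<and> mdeg a = d + e" if a: "a \<in> Poly_Mapping.keys (p * q)" for a
  proof -
    obtain b c where "b \<in> Poly_Mapping.keys p" "c \<in> Poly_Mapping.keys q" "a = b + c"
      using a keys_mult[of p q] by blast
    with assms show ?thesis
      by (auto simp: forms_def poly_ring_def mdeg_add intro!: monomials_add)
  qed
  then show ?thesis by (auto simp: forms_def poly_ring_def)
qed

lemma forms_power: "p \<in> forms n 1 \<Longrightarrow> p ^ s \<in> forms n s"
proof (induction s)
  case 0
  then show ?case by (simp add: forms_def poly_ring_def monomials_def mdeg_def)
next
  case (Suc s)
  then show ?case using forms_times[of p n 1 "p ^ s" s] by simp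
qed

section \<open>Transfer to the quotient ring\<close>

lemma poly_ring_simps [simp]:
  "p \<oplus>\<^bsub>poly_ring n\<^esub> q = p + q" "p \<otimes>\<^bsub>poly_ring n\<^esub> q = p * q"
  "\<zero>\<^bsub>poly_ring n\<^esub> = 0" "\<one>\<^bsub>poly_ring n\<^esub> = 1"
  by (simp_all add: poly_ring_def)

lemma poly_ring_pow: "p [^]\<^bsub>poly_ring n\<^esub> (s :: nat) = (p ^ s :: 'k::comm_ring_1 polynomial)"
proof -
  interpret cring "poly_ring n :: 'k polynomial ring" by (rule cring_poly_ring)
  show ?thesis by (induction s) (simp_all add: mult.commute)
qed

lemma poly_ring_uminus:
  assumes "(p :: 'k::comm_ring_1 polynomial) \<in> carrier (poly_ring n)"
  shows "\<ominus>\<^bsub>poly_ring n\<^esub> p = - p"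
proof -
  interpret cring "poly_ring n :: 'k polynomial ring" by (rule cring_poly_ring)
  show ?thesis
    by (rule minus_equality) (use assms in \<open>auto simp: poly_ring_def\<close>)
qed

text \<open>A divisor of the square-free monomial of a face is again the square-free monomial of a
  face. If such a monomial occurs in q p, then a divisor of it occurs in p.\<close>

lemma face_free_ideal:
  assumes "\<And>S. S \<in> \<Delta> \<Longrightarrow> finite S" "\<And>S T. S \<in> \<Delta> \<Longrightarrow> T \<subseteq> S \<Longrightarrow> T \<in> \<Delta>"
  shows "ideal {p \<in> carrier (poly_ring n). face_coeffs \<Delta> p = (\<lambda>_. 0)}
    (poly_ring n :: 'k::comm_ring_1 polynomial ring)" (is "ideal ?J ?R")
proof -
  interpret cring ?R by (rule cring_poly_ring)
  have lookup: "(face_coeffs \<Delta> p = (\<lambda>_. 0)) \<longleftrightarrow> (\<forall>S\<in>\<Delta>. Poly_Mapping.lookup p (sqfree_mon S) = 0)"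
    for p :: "'k polynomial" by (auto simp: face_coeffs_def fun_eq_iff)
  have times: "face_coeffs \<Delta> (q * p) = (\<lambda>_. 0)" if p: "face_coeffs \<Delta> p = (\<lambda>_. 0)" for p q :: "'k polynomial"
    unfolding lookup
  proof (rule ballI, rule ccontr)
    fix S assume S: "S \<in> \<Delta>" "Poly_Mapping.lookup (q * p) (sqfree_mon S) \<noteq> 0"
    then have "sqfree_mon S \<in> Poly_Mapping.keys (q * p)" by (simp add: in_keys_iff)
    then obtain a b where ab: "b \<in> Poly_Mapping.keys p" "sqfree_mon S = a + b"
      using keys_mult[of q p] by blast
    \<comment> \<open>The factor b divides the monomial of S, which bounds its exponents and
      confines its support to S.\<close>
    have le: "Poly_Mapping.lookup b v \<le> (if v \<in> S then 1 else 0)" for v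
      using ab(2) lookup_sqfree_mon[OF assms(1)[OF S(1)], of v] by (simp add: lookup_add)
    have "Poly_Mapping.lookup b v \<le> 1" for v using le[of v] by (simp split: if_splits)
    then have "sqfree_monomial b" by (simp add: sqfree_monomial_def)
    then have "b = sqfree_mon (Poly_Mapping.keys b)" by (simp add: sqfree_mon_keys)
    moreover have "Poly_Mapping.keys b \<subseteq> S"
    proof
      fix v assume "v \<in> Poly_Mapping.keys b"
      then show "v \<in> S" using le[of v] by (auto simp: in_keys_iff split: if_splits)
    qed
    then have "Poly_Mapping.keys b \<in> \<Delta>" using assms(2) S(1) by blast
    ultimately show False using p ab(1) unfolding lookup by (metis in_keys_iff)
  qed
  show ?thesis
  proof (rule idealI)
    show "ring ?R" by (rule ring_axioms)
    show "subgroup ?J (add_monoid ?R)"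
    proof (rule group.subgroupI[OF a_group])
      show "?J \<noteq> {}" using zero_closed by (auto simp: face_coeffs_def fun_eq_iff intro!: exI[of _ 0])
    next
      fix p assume "p \<in> ?J"
      then have "p \<in> carrier ?R" "- p \<in> carrier ?R" "face_coeffs \<Delta> (- p) = (\<lambda>_. 0)"
        using a_inv_closed[of p] poly_ring_uminus[of p n] unfolding lookup by auto
      then show "inv\<^bsub>add_monoid ?R\<^esub> p \<in> ?J"
        using poly_ring_uminus[of p n] by (simp add: a_inv_def)
    next
      fix p q assume "p \<in> ?J" "q \<in> ?J"
      then show "p \<otimes>\<^bsub>add_monoid ?R\<^esub> q \<in> ?J"
        using a_closed[of p q] unfolding lookup by (simp add: lookup_add)
    qed (auto)
  next
    fix p q assume "p \<in> ?J" "q \<in> carrier ?R"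
    then show "q \<otimes>\<^bsub>?R\<^esub> p \<in> ?J" "p \<otimes>\<^bsub>?R\<^esub> q \<in> ?J"
      using times m_closed[of q p] by (auto simp: mult.commute)
  qed
qed

section \<open>Membership in monomial ideals\<close>

lemma sum_singles: "(\<Sum>a\<in>Poly_Mapping.keys p. Poly_Mapping.single a (Poly_Mapping.lookup p a)) = p"
  by (rule poly_mapping_eqI) (auto simp: lookup_sum lookup_single when_def in_keys_iff)

text \<open>p is the sum of its terms, each a monomial in I times a constant;
  \<open>Poly_Mapping.single 0 c\<close> is the constant polynomial c.\<close>

lemma monomial_ideal_mem:
  fixes p :: "'k::comm_ring_1 polynomial"
  assumes "ideal I (poly_ring n)" "\<And>a. a \<in> Poly_Mapping.keys p \<Longrightarrow> mono_poly a \<in> I"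
    and "p \<in> carrier (poly_ring n)"
  shows "p \<in> I"
proof -
  interpret ideal I "poly_ring n" by (rule assms(1))
  have "(\<Sum>a\<in>A. Poly_Mapping.single a (Poly_Mapping.lookup p a)) \<in> I"
    if "finite A" "A \<subseteq> Poly_Mapping.keys p" for A
    using that
  proof (induction A)
    case empty
    then show ?case using additive_subgroup.zero_closed[OF is_additive_subgroup] by simp
  next
    case (insert a A)
    have "Poly_Mapping.single 0 (Poly_Mapping.lookup p a) \<otimes>\<^bsub>poly_ring n\<^esub> mono_poly a \<in> I"
      using insert.prems assms(2) by (intro I_l_closed) (auto simp: poly_ring_def monomials_def)
    then have "Poly_Mapping.single a (Poly_Mapping.lookup p a) \<in> I"
      by (simp add: mono_poly_def mult_single)
    moreover have "(\<Sum>a\<in>A. Poly_Mapping.single a (Poly_Mapping.lookup p a)) \<in> I"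
      using insert by blast
    ultimately show ?case
      using additive_subgroup.a_closed[OF is_additive_subgroup] insert.hyps by fastforce
  qed
  then show ?thesis using sum_singles[of p] finite_keys by (metis order_refl)
qed

lemma mono_poly_times: "mono_poly a * mono_poly b = mono_poly (a + b)"
  by (simp add: mono_poly_def mult_single)

lemma monomial_ideal_multiple:
  assumes "ideal I (poly_ring n :: 'k::comm_ring_1 polynomial ring)" "mono_poly a \<in> I" "b \<in> monomials n"
  shows "mono_poly (a + b) \<in> I"
proof -
  interpret ideal I "poly_ring n" by (rule assms(1))
  have "mono_poly a \<otimes>\<^bsub>poly_ring n\<^esub> mono_poly b \<in> I"
    using assms(2) mono_poly_carrier[OF assms(3)] by (rule I_r_closed)
  then show ?thesis by (simp add: mono_poly_times)
qed

text \<open>Divisibility of monomials; the truncated subtraction a - b is exact because b is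
  pointwise below a.\<close>

lemma monomial_split:
  fixes a b :: monomial
  assumes "\<And>v. Poly_Mapping.lookup b v \<le> Poly_Mapping.lookup a v" "a \<in> monomials n"
  obtains c where "a = b + c" "c \<in> monomials n"
proof
  show "a = b + (a - b)"
    using assms(1) by (intro poly_mapping_eqI) (simp add: lookup_add lookup_minus)
  show "a - b \<in> monomials n"
    using assms(2) by (auto simp: monomials_def in_keys_iff lookup_minus)
qed

text \<open>All generators have zero face coefficients, and the polynomials with this property form
  an ideal. Conversely, each monomial occurring in such a polynomial is divisible by some x_v^2 or
  is square-free with a forbidden pair in its support; either way it is a multiple of a
  generator.\<close>

lemma squares_plus_RLex_mem_iff:
  fixes p :: "'k::comm_ring_1 polynomial"
  assumes "1 \<le> i" "i < j" "j \<le> n" and p: "p \<in> carrier (poly_ring n)"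
  shows "p \<in> squares_ideal n <+>\<^bsub>poly_ring n\<^esub> RLex n (expo i + expo j) \<longleftrightarrow>
    face_coeffs (faces i j n) p = (\<lambda>_. 0)" (is "p \<in> ?I \<longleftrightarrow> _")
proof -
  let ?R = "poly_ring n :: 'k polynomial ring" and ?\<Delta> = "faces i j n"
  let ?J = "{p \<in> carrier ?R. face_coeffs ?\<Delta> p = (\<lambda>_. 0)}"
  let ?sq = "{var v ^ 2 | v. v \<in> {1..n}} :: 'k polynomial set"
  let ?gens = "mono_poly ` RLex_gens n (expo i + expo j) :: 'k polynomial set"
  interpret cring ?R by (rule cring_poly_ring)
  have J: "ideal ?J ?R" by (rule face_free_ideal) (erule faces_finite, rule faces_mono)
  have I: "ideal ?I ?R" by (rule ideal_squares_plus_RLex)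
  have sq_carrier: "?sq \<subseteq> carrier ?R"
  proof safe
    fix v assume "v \<in> {1..n}"
    from m_closed[OF var_carrier[OF this] var_carrier[OF this]]
    show "(var v :: 'k polynomial) ^ 2 \<in> carrier ?R" by (simp add: power2_eq_square)
  qed
  have gens_carrier: "?gens \<subseteq> carrier ?R"
    by (auto simp: RLex_gens_def intro: mono_poly_carrier)
  have var_sq: "var v ^ 2 = (mono_poly (expo v + expo v) :: 'k polynomial)" for v
    by (simp add: var_def power2_eq_square mono_poly_times)
  have gens: "a \<in> RLex_gens n (expo i + expo j) \<longleftrightarrow>
      (\<exists>b c. a = expo b + expo c \<and> 1 \<le> b \<and> b < c \<and> (c < j \<or> c = j \<and> b \<le> i))" for a
  proof -
    have "1 \<le> b \<and> b < c \<and> (c < j \<or> c = j \<and> b \<le> i) \<longleftrightarrow>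
        (1 \<le> b \<and> b < c \<and> c \<le> j - 1) \<or> (c = j \<and> 1 \<le> b \<and> b \<le> i)" for b c
      using assms by auto
    then show ?thesis unfolding RLex_gens_quadratic[OF assms(1-3)] by blast
  qed
  have mono_J: "mono_poly a \<in> ?J" if "a \<in> monomials n" "\<And>S. S \<in> ?\<Delta> \<Longrightarrow> a \<noteq> sqfree_mon S" for a
    using that mono_poly_carrier[OF that(1)]
    by (auto simp: face_coeffs_def mono_poly_def lookup_single when_def)
  have "?I \<subseteq> ?J"
  proof -
    have "?sq \<subseteq> ?J"
    proof
      fix q assume "q \<in> ?sq"
      then obtain v where v: "v \<in> {1..n}" "q = mono_poly (expo v + expo v)" using var_sq by auto
      have "expo v + expo v \<noteq> sqfree_mon S" if "S \<in> ?\<Delta>" for S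
      proof
        assume "expo v + expo v = sqfree_mon S"
        then have "Poly_Mapping.lookup (expo v + expo v) v \<le> 1"
          by (simp add: lookup_sqfree_mon[OF faces_finite[OF that]])
        then show False by (simp add: lookup_add)
      qed
      moreover have "expo v + expo v \<in> monomials n"
        using v(1) by (intro monomials_add) (simp_all add: monomials_def)
      ultimately show "q \<in> ?J" unfolding v(2) by (intro mono_J)
    qed
    then have sq: "squares_ideal n \<subseteq> ?J"
      unfolding squares_ideal_def by (rule genideal_minimal[OF J])
    have "?gens \<subseteq> ?J"
    proof
      fix q assume "q \<in> ?gens"
      then obtain a where a: "a \<in> RLex_gens n (expo i + expo j)" "q = mono_poly a" by blast
      then obtain b c where bc: "a = expo b + expo c" "b < c" "c < j \<or> c = j \<and> b \<le> i"
        unfolding gens by blast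
      have "a \<noteq> sqfree_mon S" if "S \<in> ?\<Delta>" for S
      proof
        assume "a = sqfree_mon S"
        then have "Poly_Mapping.keys a = S" using keys_sqfree_mon[OF faces_finite[OF that]] by simp
        moreover have "{b, c} \<subseteq> Poly_Mapping.keys a"
          by (auto simp: bc(1) in_keys_iff lookup_add lookup_single)
        ultimately show False using that bc(2,3) by (auto simp: faces_def)
      qed
      moreover have "a \<in> monomials n" using a(1) by (simp add: RLex_gens_def)
      ultimately show "q \<in> ?J" unfolding a(2) by (intro mono_J)
    qed
    then have "RLex n (expo i + expo j) \<subseteq> ?J"
      unfolding RLex_def by (rule genideal_minimal[OF J])
    with sq show ?thesis unfolding set_add_def' using additive_subgroup.a_closed[OF ideal.axioms(1)[OF J]] by blast
  qed
  moreover have "p \<in> ?I" if "face_coeffs ?\<Delta> p = (\<lambda>_. 0)"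
  proof (rule monomial_ideal_mem[OF I _ p])
    have S: "ideal (squares_ideal n) ?R"
      unfolding squares_ideal_def by (rule genideal_ideal[OF sq_carrier])
    have L: "ideal (RLex n (expo i + expo j)) ?R"
      unfolding RLex_def by (rule genideal_ideal[OF gens_carrier])
    \<comment> \<open>Used with zero as one of the summands, this embeds both ideals in their
      sum.\<close>
    have sumI: "x + y \<in> ?I" if "x \<in> squares_ideal n" "y \<in> RLex n (expo i + expo j)" for x y
      unfolding set_add_def' poly_ring_simps using that by blast
    have sqI: "mono_poly (expo v + expo v) \<in> ?I" if "v \<in> {1..n}" for v
    proof -
      have "(var v ^ 2 :: 'k polynomial) \<in> squares_ideal n"
        unfolding squares_ideal_def
        by (rule subsetD[OF genideal_self[OF sq_carrier]]) (use that in blast)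
      then show ?thesis
        using sumI[OF _ additive_subgroup.zero_closed[OF ideal.axioms(1)[OF L]]] var_sq[of v] by simp
    qed
    have genI: "mono_poly a \<in> ?I" if "a \<in> RLex_gens n (expo i + expo j)" for a
    proof -
      have "(mono_poly a :: 'k polynomial) \<in> RLex n (expo i + expo j)"
        unfolding RLex_def by (rule subsetD[OF genideal_self[OF gens_carrier]]) (use that in blast)
      then show ?thesis
        using sumI[OF additive_subgroup.zero_closed[OF ideal.axioms(1)[OF S]]] by simp
    qed
    fix a assume a: "a \<in> Poly_Mapping.keys p"
    then have mon: "a \<in> monomials n" using p by (auto simp: poly_ring_def)
    show "mono_poly a \<in> ?I"
    proof (cases "sqfree_monomial a")
      case True
      then have "Poly_Mapping.keys a \<notin> ?\<Delta>"
        using that a sqfree_mon_keys[OF True] by (metis face_coeffs_def in_keys_iff)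
      with mon obtain b c where bc: "b \<in> Poly_Mapping.keys a" "c \<in> Poly_Mapping.keys a"
        "b < c" "c < j \<or> c = j \<and> b \<le> i"
        by (auto simp: faces_def monomials_def)
      have "Poly_Mapping.lookup (expo b + expo c) v \<le> Poly_Mapping.lookup a v" for v
        using bc(1-3) by (auto simp: lookup_add lookup_single when_def in_keys_iff)
      then obtain m where m: "a = expo b + expo c + m" "m \<in> monomials n"
        using monomial_split mon by blast
      have "1 \<le> b" using bc(1) mon by (auto simp: monomials_def)
      then have "mono_poly (expo b + expo c) \<in> ?I" using bc genI gens by blast
      then show ?thesis using monomial_ideal_multiple[OF I _ m(2)] m(1) by metis
    next
      case False
      then obtain v where v: "2 \<le> Poly_Mapping.lookup a v"
        unfolding sqfree_monomial_def by (metis One_nat_def not_less_eq_eq numeral_2_eq_2)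
      then have "v \<in> Poly_Mapping.keys a" by (simp add: in_keys_iff)
      then have "mono_poly (expo v + expo v) \<in> ?I" using mon by (intro sqI) (auto simp: monomials_def)
      moreover have "Poly_Mapping.lookup (expo v + expo v) w \<le> Poly_Mapping.lookup a w" for w
        using v by (auto simp: lookup_add lookup_single when_def)
      then obtain m where m: "a = expo v + expo v + m" "m \<in> monomials n"
        using monomial_split mon by blast
      ultimately show ?thesis using monomial_ideal_multiple[OF I _ m(2)] m(1) by metis
    qed
  qed
  ultimately show ?thesis by blast
qed

lemma strong_LefschetzI:
  fixes I :: "'k::comm_ring_1 polynomial set"
  assumes I: "ideal I (poly_ring n)"
    and mem: "\<And>p. p \<in> carrier (poly_ring n) \<Longrightarrow> p \<in> I \<longleftrightarrow> face_coeffs \<Delta> p = (\<lambda>_. 0)"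
    and sub: "\<And>S. S \<in> \<Delta> \<Longrightarrow> S \<subseteq> {1..n}" and down: "\<And>S T. S \<in> \<Delta> \<Longrightarrow> T \<subseteq> S \<Longrightarrow> T \<in> \<Delta>"
    and lef: "lefschetz_at TYPE('k) \<Delta> N"
  shows "strong_Lefschetz (poly_ring n Quot I) (quot_component n I)"
proof -
  let ?R = "poly_ring n :: 'k polynomial ring"
  let ?l = "\<Sum>v\<in>{1..n}. var v :: 'k polynomial" and ?\<pi> = "\<lambda>p. I +>\<^bsub>?R\<^esub> p"
  let ?A = "?R Quot I"
  interpret cring ?R by (rule cring_poly_ring)
  interpret ideal I ?R by (rule I)
  have fin: "finite S" if "S \<in> \<Delta>" for S using sub[OF that] finite_subset by blast
  have "finite \<Delta>" using sub by (intro finite_subset[of \<Delta> "Pow {1..n}"]) auto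
  have carr: "p \<in> carrier ?R" if "p \<in> forms n d" for p d using that by (simp add: forms_def)
  have l: "?l \<in> forms n 1" by (rule sum_vars_form)
  have hom: "?\<pi> \<in> ring_hom ?R ?A" by (rule rcos_ring_hom)
  interpret h: ring_hom_ring ?R ?A ?\<pi>
    by (rule ring_hom_ringI2[OF ring_axioms quotient_is_ring hom])
  have mult: "(?\<pi> ?l [^]\<^bsub>?A\<^esub> s) \<otimes>\<^bsub>?A\<^esub> ?\<pi> p = ?\<pi> (?l ^ s * p)" if "p \<in> carrier ?R" for s :: nat and p
    using h.hom_nat_pow[OF carr[OF l], of s] h.hom_mult[OF carr[OF forms_power[OF l, of s]] that]
    by (simp add: poly_ring_pow)
  have eq_iff: "?\<pi> p = ?\<pi> q \<longleftrightarrow> face_coeffs \<Delta> (p - q) = (\<lambda>_. 0)"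
    if "p \<in> forms n d" "q \<in> forms n d" for p q d
    using quotient_eq_iff_same_a_r_cos[OF I carr[OF that(1)] carr[OF that(2)]]
      mem[OF carr[OF forms_diff[OF that]]] poly_ring_uminus[OF carr[OF that(2)]]
    by (simp add: a_minus_def)
  have pow_form: "?l ^ s * p \<in> forms n (d + s)" if "p \<in> forms n d" for p s d
    using forms_times[OF forms_power[OF l, of s] that] by (simp only: add.commute[of d s])
  have pow_coeffs: "face_coeffs \<Delta> (?l ^ s * p) = (raise \<Delta> ^^ s) (face_coeffs \<Delta> p)" for s p
    using sub down by (rule face_coeffs_linear_form_pow_times)
  show ?thesis unfolding strong_Lefschetz_def
  proof (intro bexI[of _ "?\<pi> ?l"] allI)
    show "?\<pi> ?l \<in> quot_component n I 1" unfolding quot_component_def using l by blast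
    fix s d :: nat
    let ?m = "\<lambda>a. (?\<pi> ?l [^]\<^bsub>?A\<^esub> s) \<otimes>\<^bsub>?A\<^esub> a"
    show "inj_on ?m (quot_component n I d) \<or> ?m ` quot_component n I d = quot_component n I (d + s)"
    proof (cases "2 * d + s \<le> N")
      case True
      have "?\<pi> p = ?\<pi> q" if pq: "p \<in> forms n d" "q \<in> forms n d" and eq: "?m (?\<pi> p) = ?m (?\<pi> q)" for p q
      proof -
        have "?\<pi> (?l ^ s * p) = ?\<pi> (?l ^ s * q)"
          using eq mult carr pq by metis
        then have "face_coeffs \<Delta> (?l ^ s * p - ?l ^ s * q) = (\<lambda>_. 0)"
          using eq_iff[OF pow_form[OF pq(1)] pow_form[OF pq(2)]] by blast
        then have "(raise \<Delta> ^^ s) (face_coeffs \<Delta> (p - q)) = (\<lambda>_. 0)"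
          using pow_coeffs[of s "p - q"] by (simp only: right_diff_distrib)
        moreover have "face_coeffs \<Delta> (p - q) \<in> cochains \<Delta> d"
          by (rule face_coeffs_cochains[OF forms_diff[OF pq] fin])
        ultimately have "face_coeffs \<Delta> (p - q) = (\<lambda>_. 0)"
          using lef True unfolding lefschetz_at_def by blast
        then show ?thesis using eq_iff[OF pq] by blast
      qed
      then have "inj_on ?m (quot_component n I d)"
        unfolding quot_component_def inj_on_def by blast
      then show ?thesis ..
    next
      case False
      have "?m ` quot_component n I d = ?\<pi> ` (\<lambda>p. ?l ^ s * p) ` forms n d"
        unfolding quot_component_def image_image using mult[OF carr] by (intro image_cong) auto
      also have "\<dots> = quot_component n I (d + s)"
      proof
        show "?\<pi> ` (\<lambda>p. ?l ^ s * p) ` forms n d \<subseteq> quot_component n I (d + s)"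
          unfolding quot_component_def using pow_form by blast
        show "quot_component n I (d + s) \<subseteq> ?\<pi> ` (\<lambda>p. ?l ^ s * p) ` forms n d"
          unfolding quot_component_def
        proof
          fix x assume "x \<in> ?\<pi> ` forms n (d + s)"
          then obtain q where q: "q \<in> forms n (d + s)" "x = ?\<pi> q" by blast
          obtain f where f: "f \<in> cochains \<Delta> d" "(raise \<Delta> ^^ s) f = face_coeffs \<Delta> q"
            using lef False face_coeffs_cochains[OF q(1) fin]
            unfolding lefschetz_at_def not_le by blast
          obtain p where p: "p \<in> forms n d" "face_coeffs \<Delta> p = f"
            using face_coeffs_surj[OF f(1) \<open>finite \<Delta>\<close> sub] by blast
          have "face_coeffs \<Delta> (?l ^ s * p) = face_coeffs \<Delta> q"
            using pow_coeffs[of s p] p(2) f(2) by metis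
          then have "face_coeffs \<Delta> (?l ^ s * p - q) = (\<lambda>_. 0)"
            unfolding face_coeffs_diff by simp
          then have "?\<pi> (?l ^ s * p) = x"
            using eq_iff[OF pow_form[OF p(1)] q(1)] q(2) by blast
          then show "x \<in> ?\<pi> ` (\<lambda>p. ?l ^ s * p) ` forms n d" using p(1) by blast
        qed
      qed
      finally show ?thesis ..
    qed
  qed
qed

theorem theorem2p11:
  fixes n i j :: nat
    and R :: "'k::field_char_0 polynomial ring"
    and I :: "'k polynomial set"
  assumes "1 \<le> i" and "i < j" and "j \<le> n"
  defines "R \<equiv> poly_ring n"
    and "I \<equiv> squares_ideal n <+>\<^bsub>poly_ring n\<^esub> RLex n (expo i + expo j)"
  shows "strong_Lefschetz (R Quot I) (quot_component n I)"
proof -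
  obtain N where "lefschetz_at TYPE('k) (faces i j n) N"
    using lefschetz_at_faces[OF assms(1-3)] by blast
  then show ?thesis
    unfolding R_def I_def
    by (intro strong_LefschetzI[OF ideal_squares_plus_RLex squares_plus_RLex_mem_iff[OF assms(1-3)]])
      (auto simp: faces_def)
qed

end
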